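(* For integers $q,r\ge2$ and every integer $k$ with $1\le k\le 2q+2r-4$, the grid graph satisfies $\operatorname{wdim}_k(P_q\Box P_r)=k$ if $k$ is even and $\operatorname{wdim}_k(P_q\Box P_r)=k+1$ if $k$ is odd.
   Context: All graphs are finite, simple and connected; $d(u,v)$ is the distance. $P_q\Box P_r$ is the Cartesian product of paths on $q$ and $r$ vertices. For vertices $x,y,s$ put $\Delta_s(x,y)=|d(x,s)-d(y,s)|$, $\Delta_S(x,y)=\sum_{s\in S}\Delta_s(x,y)$. For $k\ge1$, $S\subseteq V(G)$ is a weak $k$-resolving set if $\Delta_S(x,y)\ge k$ for all distinct $x,y\in V(G)$; $\operatorname{wdim}_k(G)$ is the minimum cardinality of a weak $k$-resolving set. *)

theory Defs
  imports "Graph_Theory.Graph_Theory" "HOL-Library.Extended_Nat"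
begin

text \<open>
  A finite simple graph is a \<^locale>\<open>pair_graph\<close>: a finite symmetric loopfree digraph whose
  arcs are pairs of vertices, each edge being represented by its two orientations.
\<close>

definition path_graph :: "nat \<Rightarrow> nat pair_pre_digraph" where
  "path_graph n = \<lparr> pverts = {..<n},
     parcs = {(i, j). i < n \<and> j < n \<and> (j = Suc i \<or> i = Suc j)} \<rparr>"

definition cart_prod ::
    "'a pair_pre_digraph \<Rightarrow> 'b pair_pre_digraph \<Rightarrow> ('a \<times> 'b) pair_pre_digraph"
    (infixl \<open>\<box>\<close> 70) where
  "G \<box> H = \<lparr> pverts = pverts G \<times> pverts H,
     parcs = {((a, b), (c, d)).
       (a = c \<and> a \<in> pverts G \<and> (b, d) \<in> parcs H) \<or>
       ((a, c) \<in> parcs G \<and> b = d \<and> b \<in> pverts H)} \<rparr>"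

text \<open>
  The distance is the length of a shortest walk; it is unspecified if \<open>v\<close> is not reachable
  from \<open>u\<close>, which does not occur in a connected graph.
\<close>
definition gdist :: "'a pair_pre_digraph \<Rightarrow> 'a \<Rightarrow> 'a \<Rightarrow> nat" where
  "gdist G u v = (LEAST n. \<exists>p. pre_digraph.awalk (with_proj G) u p v \<and> length p = n)"

definition Delta1 :: "'a pair_pre_digraph \<Rightarrow> 'a \<Rightarrow> 'a \<Rightarrow> 'a \<Rightarrow> int" where
  "Delta1 G s x y = \<bar>int (gdist G x s) - int (gdist G y s)\<bar>"

definition Delta :: "'a pair_pre_digraph \<Rightarrow> 'a set \<Rightarrow> 'a \<Rightarrow> 'a \<Rightarrow> int" where
  "Delta G S x y = (\<Sum>s\<in>S. Delta1 G s x y)"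

definition weak_resolving :: "'a pair_pre_digraph \<Rightarrow> nat \<Rightarrow> 'a set \<Rightarrow> bool" where
  "weak_resolving G k S \<longleftrightarrow> S \<subseteq> pverts G \<and>
     (\<forall>x\<in>pverts G. \<forall>y\<in>pverts G. x \<noteq> y \<longrightarrow> int k \<le> Delta G S x y)"

text \<open>
  The minimum cardinality is taken in \<^typ>\<open>enat\<close>, so that its value is \<open>\<infinity>\<close> exactly when \<open>G\<close> has
  no weak \<open>k\<close>-resolving set. Only finite graphs are intended, hence \<open>S\<close> is always finite.
\<close>
definition wdim :: "nat \<Rightarrow> 'a pair_pre_digraph \<Rightarrow> enat" where
  "wdim k G = (INF S \<in> {S. weak_resolving G k S}. enat (card S))"

lemma pair_graph_path_graph: "pair_graph (path_graph n)"
proof -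
  have "finite {(i, j). i < n \<and> j < n \<and> (j = Suc i \<or> i = Suc j)}"
    by (rule finite_subset[of _ "{..<n} \<times> {..<n}"]) auto
  then show ?thesis
    by unfold_locales (auto simp: path_graph_def symmetric_def sym_def)
qed

lemma pair_graph_cart_prod:
  assumes "pair_graph G" "pair_graph H"
  shows "pair_graph (G \<box> H)"
proof -
  interpret G: pair_graph G by fact
  interpret H: pair_graph H by fact
  have "parcs (G \<box> H) \<subseteq> (pverts G \<times> pverts H) \<times> (pverts G \<times> pverts H)"
    by (auto simp: cart_prod_def dest: G.in_arcsD1 G.in_arcsD2 H.in_arcsD1 H.in_arcsD2)
  moreover have "finite ((pverts G \<times> pverts H) \<times> (pverts G \<times> pverts H))"
    by simp
  ultimately have "finite (parcs (G \<box> H))"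
    by (rule finite_subset)
  moreover have "sym (parcs G)" "sym (parcs H)"
    using G.pair_sym_arcs H.pair_sym_arcs by (auto simp: symmetric_def)
  ultimately show ?thesis
    by unfold_locales
      (auto simp: cart_prod_def symmetric_def sym_def
         dest: G.in_arcsD1 G.in_arcsD2 H.in_arcsD1 H.in_arcsD2 G.pair_no_loops H.pair_no_loops)
qed

text \<open>The distance agrees with the shortest-path distance of the library for unit weights.\<close>
lemma gdist_eq_mu:
  assumes "pair_wf_digraph G" and "u \<rightarrow>\<^sup>*\<^bsub>with_proj G\<^esub> v"
  shows "ereal (real (gdist G u v)) = wf_digraph.\<mu> (with_proj G) (\<lambda>_. 1) u v"
proof -
  interpret G: pair_wf_digraph G by fact
  have cost: "G.awalk_cost (\<lambda>_. 1) p = real (length p)" for p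
    by (simp add: G.awalk_cost_def sum_list_triv)
  obtain p0 where "G.awalk u p0 v"
    using iffD1[OF G.reachable_awalk assms(2)] by (elim exE)
  then have "\<exists>n p. G.awalk u p v \<and> length p = n"
    by blast
  then have "\<exists>p. G.awalk u p v \<and> length p = gdist G u v"
    unfolding gdist_def by (rule LeastI_ex)
  then obtain p where p: "G.awalk u p v" "length p = gdist G u v"
    by blast
  have "gdist G u v \<le> length p'" if "G.awalk u p' v" for p'
    unfolding gdist_def by (rule Least_le) (use that in blast)
  then have "ereal (real (gdist G u v)) \<le> G.\<mu> (\<lambda>_. 1) u v"
    unfolding G.\<mu>_def cost by (intro INF_greatest) simp
  moreover have "G.\<mu> (\<lambda>_. 1) u v \<le> ereal (real (gdist G u v))"
    using G.min_cost_le_walk_cost[OF p(1), of "\<lambda>_. 1"] by (simp only: cost p(2))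
  ultimately show ?thesis
    by (rule antisym)
qed

end

theory Submission
  imports Defs
begin

text \<open>
  Distances in the grid are \<open>\<ell>\<^sub>1\<close>-distances.

  Lower bound: an arc \<open>xy\<close> has \<open>\<Delta>\<^sub>s(x,y) \<le> 1\<close>, so \<open>k \<le> |S|\<close>. The two diagonals of a unit square
  both have an even \<open>\<Delta>\<^sub>S\<close>, and these two values add up to \<open>2|S|\<close>; hence \<open>|S| = k\<close> is impossible
  for odd \<open>k\<close>.

  Upper bound: take \<open>m\<close> pairs of opposite boundary vertices, among them the two corners of one
  side. Every pair contributes at least \<open>2\<close> to \<open>\<Delta>\<^sub>S(x,y)\<close>, except that at most one pair, lying on
  the perpendicular bisector of \<open>x\<close> and \<open>y\<close>, contributes \<open>0\<close>; in that case \<open>d(x,y)\<close> is even and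
  the corner pair contributes at least \<open>4\<close>.
\<close>

section \<open>Distances in the grid\<close>

definition l1_dist :: "nat \<times> nat \<Rightarrow> nat \<times> nat \<Rightarrow> int" where
  "l1_dist u v = \<bar>int (fst u) - int (fst v)\<bar> + \<bar>int (snd u) - int (snd v)\<bar>"

lemma pverts_grid: "pverts (path_graph q \<box> path_graph r) = {..<q} \<times> {..<r}"
  by (simp add: cart_prod_def path_graph_def)

text \<open>An arc changes one coordinate by one, so it lowers the \<open>l1_dist\<close> to
  \<open>v\<close> by at most one; induction along the walk.\<close>

lemma l1_dist_le_awalk_length:
  assumes "pre_digraph.awalk (with_proj (path_graph q \<box> path_graph r)) u p v"
  shows "l1_dist u v \<le> int (length p)"
proof -
  interpret pair_graph "path_graph q \<box> path_graph r"
    by (intro pair_graph_cart_prod pair_graph_path_graph)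
  show ?thesis
    using assms
  proof (induction p arbitrary: u)
    case Nil
    then show ?case by (auto simp: awalk_Nil_iff l1_dist_def)
  next
    case (Cons e p)
    then have e: "e \<in> parcs (path_graph q \<box> path_graph r)" "fst e = u" and
      "awalk (snd e) p v"
      by (auto simp: awalk_Cons_iff)
    then have "l1_dist (snd e) v \<le> int (length p)"
      using Cons.IH by blast
    moreover have "l1_dist u v \<le> l1_dist (snd e) v + 1"
      using e by (cases e) (auto simp: cart_prod_def path_graph_def l1_dist_def)
    ultimately show ?case by simp
  qed
qed

text \<open>Move the first coordinate towards that of \<open>v\<close>; once they agree, move the
  second. No coordinate overshoots, so the step stays in the grid.\<close>

lemma grid_arc_towards:
  assumes "u \<in> {..<q} \<times> {..<r}" "v \<in> {..<q} \<times> {..<r}" "l1_dist u v = int (Suc n)"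
  obtains w where "(u, w) \<in> parcs (path_graph q \<box> path_graph r)" "w \<in> {..<q} \<times> {..<r}"
    "l1_dist w v = int n"
proof -
  obtain a b c d where uv: "u = (a, b)" "v = (c, d)"
    by (cases u, cases v) auto
  consider "a < c" | "c < a" | "a = c" "b < d" | "a = c" "d < b"
    using assms(3) uv by (cases a c rule: linorder_cases; cases b d rule: linorder_cases)
      (auto simp: l1_dist_def)
  then show thesis
  proof cases
    case 1
    then show thesis using assms uv
      by (intro that[of "(Suc a, b)"]) (auto simp: cart_prod_def path_graph_def l1_dist_def)
  next
    case 2
    then show thesis using assms uv
      by (intro that[of "(a - 1, b)"]) (auto simp: cart_prod_def path_graph_def l1_dist_def)
  next
    case 3
    then show thesis using assms uv
      by (intro that[of "(a, Suc b)"]) (auto simp: cart_prod_def path_graph_def l1_dist_def)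
  next
    case 4
    then show thesis using assms uv
      by (intro that[of "(a, b - 1)"]) (auto simp: cart_prod_def path_graph_def l1_dist_def)
  qed
qed

lemma ex_awalk_l1_dist:
  assumes "u \<in> {..<q} \<times> {..<r}" "v \<in> {..<q} \<times> {..<r}" "l1_dist u v = int n"
  shows "\<exists>p. pre_digraph.awalk (with_proj (path_graph q \<box> path_graph r)) u p v \<and> length p = n"
proof -
  interpret pair_graph "path_graph q \<box> path_graph r"
    by (intro pair_graph_cart_prod pair_graph_path_graph)
  show ?thesis
    using assms
  proof (induction n arbitrary: u)
    case 0
    then have "u = v" by (auto simp: l1_dist_def prod_eq_iff)
    with 0 show ?case by (auto simp: awalk_Nil_iff pverts_grid)
  next
    case (Suc n)
    obtain w where w: "(u, w) \<in> parcs (path_graph q \<box> path_graph r)" "w \<in> {..<q} \<times> {..<r}"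
      "l1_dist w v = int n"
      using grid_arc_towards[OF Suc.prems] by blast
    then obtain p where "awalk w p v" "length p = n"
      using Suc.IH Suc.prems(2) by blast
    with w(1) show ?case
      by (intro exI[of _ "(u, w) # p"]) (auto simp: awalk_Cons_iff)
  qed
qed

lemma gdist_grid:
  assumes "u \<in> {..<q} \<times> {..<r}" "v \<in> {..<q} \<times> {..<r}"
  shows "int (gdist (path_graph q \<box> path_graph r) u v) = l1_dist u v"
proof -
  have n: "l1_dist u v = int (nat (l1_dist u v))"
    by (simp add: l1_dist_def)
  have "gdist (path_graph q \<box> path_graph r) u v = nat (l1_dist u v)"
    unfolding gdist_def
  proof (rule Least_equality)
    fix m
    assume "\<exists>p. pre_digraph.awalk (with_proj (path_graph q \<box> path_graph r)) u p v \<and> length p = m"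
    then show "nat (l1_dist u v) \<le> m"
      using l1_dist_le_awalk_length by fastforce
  qed (rule ex_awalk_l1_dist[OF assms n])
  with n show ?thesis by simp
qed

lemma Delta_grid:
  assumes "S \<subseteq> {..<q} \<times> {..<r}" "x \<in> {..<q} \<times> {..<r}" "y \<in> {..<q} \<times> {..<r}"
  shows "Delta (path_graph q \<box> path_graph r) S x y = (\<Sum>s\<in>S. \<bar>l1_dist x s - l1_dist y s\<bar>)"
  unfolding Delta_def Delta1_def
proof (rule sum.cong[OF refl])
  fix s assume "s \<in> S"
  then have "s \<in> {..<q} \<times> {..<r}" using assms(1) by blast
  then show "\<bar>int (gdist (path_graph q \<box> path_graph r) x s) -
      int (gdist (path_graph q \<box> path_graph r) y s)\<bar> = \<bar>l1_dist x s - l1_dist y s\<bar>"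
    by (simp only: gdist_grid[OF assms(2)] gdist_grid[OF assms(3)])
qed

lemma weak_resolving_grid_iff:
  "weak_resolving (path_graph q \<box> path_graph r) k S \<longleftrightarrow>
    S \<subseteq> {..<q} \<times> {..<r} \<and>
    (\<forall>x\<in>{..<q} \<times> {..<r}. \<forall>y\<in>{..<q} \<times> {..<r}. x \<noteq> y \<longrightarrow>
      int k \<le> (\<Sum>s\<in>S. \<bar>l1_dist x s - l1_dist y s\<bar>))"
  unfolding weak_resolving_def pverts_grid by (auto simp: Delta_grid)

section \<open>Lower bound\<close>

lemma weak_resolving_grid_card_ge:
  assumes "q \<ge> 2" "r \<ge> 2" and res: "weak_resolving (path_graph q \<box> path_graph r) k S"
  shows "(if even k then k else k + 1) \<le> card S"
proof -
  define D where "D x y = (\<Sum>s\<in>S. \<bar>l1_dist x s - l1_dist y s\<bar>)" for x y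
  have D_ge: "int k \<le> D x y" if "x \<in> {..<q} \<times> {..<r}" "y \<in> {..<q} \<times> {..<r}" "x \<noteq> y" for x y
    using res that unfolding weak_resolving_grid_iff D_def by blast
  have "D (0, 0) (0, 1) \<le> (\<Sum>s\<in>S. 1)"
    unfolding D_def by (intro sum_mono) (auto simp: l1_dist_def)
  with D_ge[of "(0, 0)" "(0, 1)"] assms have k: "k \<le> card S" by auto
  \<comment> \<open>The corner of the unit square nearest to \<open>s\<close> and its opposite
    corner differ by 2 in distance from \<open>s\<close>; the other two corners are equidistant from
    \<open>s\<close>.\<close>
  have "\<bar>l1_dist (0, 0) s - l1_dist (1, 1) s\<bar> + \<bar>l1_dist (0, 1) s - l1_dist (1, 0) s\<bar> = 2" for s
    by (cases "fst s = 0"; cases "snd s = 0") (simp_all add: l1_dist_def)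
  then have "D (0, 0) (1, 1) + D (0, 1) (1, 0) = (\<Sum>s\<in>S. 2)"
    unfolding D_def sum.distrib[symmetric] by simp
  then have two: "D (0, 0) (1, 1) + D (0, 1) (1, 0) = 2 * int (card S)" by simp
  have "even (D (0, 0) (1, 1))" "even (D (0, 1) (1, 0))"
    unfolding D_def by (intro dvd_sum; simp add: l1_dist_def; presburger)+
  moreover have "int k \<le> D (0, 0) (1, 1)" "int k \<le> D (0, 1) (1, 0)"
    using D_ge assms by auto
  \<comment> \<open>For odd \<open>k\<close> both even values are at least \<open>k + 1\<close>, so
    their sum \<open>2 * card S\<close> is at least \<open>2 * k + 2\<close>.\<close>
  ultimately show ?thesis
    using two k by presburger
qed

section \<open>Upper bound: opposite pairs of boundary vertices\<close>

lemma abs_add_plus_abs_diff: "\<bar>u + v\<bar> + \<bar>u - v\<bar> = 2 * max \<bar>u\<bar> \<bar>v\<bar>" for u v :: int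
  by linarith

text \<open>Passing to the opposite side reverses the sign of the first coordinate's contribution
  \<open>int a - int c\<close> and keeps that of the second, so the two terms are |u + v| and |u -
  v|.\<close>

lemma side_pair_contribution:
  assumes "a < q" "c < q"
  shows "\<bar>l1_dist (a, b) (0, j) - l1_dist (c, d) (0, j)\<bar> +
      \<bar>l1_dist (a, b) (q - 1, j) - l1_dist (c, d) (q - 1, j)\<bar> =
    2 * max \<bar>int a - int c\<bar> \<bar>\<bar>int b - int j\<bar> - \<bar>int d - int j\<bar>\<bar>"
proof -
  have "l1_dist (a, b) (0, j) - l1_dist (c, d) (0, j) = (int a - int c) + (\<bar>int b - int j\<bar> - \<bar>int d - int j\<bar>)"
    by (simp add: l1_dist_def)
  moreover have "l1_dist (a, b) (q - 1, j) - l1_dist (c, d) (q - 1, j) = - ((int a - int c) - (\<bar>int b - int j\<bar> - \<bar>int d - int j\<bar>))"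
    using assms by (simp add: l1_dist_def of_nat_diff)
  ultimately show ?thesis
    by (simp only: abs_minus_cancel abs_add_plus_abs_diff)
qed

lemma top_bottom_pair_contribution:
  assumes "b < r" "d < r"
  shows "\<bar>l1_dist (a, b) (i, 0) - l1_dist (c, d) (i, 0)\<bar> +
      \<bar>l1_dist (a, b) (i, r - 1) - l1_dist (c, d) (i, r - 1)\<bar> =
    2 * max \<bar>int b - int d\<bar> \<bar>\<bar>int a - int i\<bar> - \<bar>int c - int i\<bar>\<bar>"
proof -
  have "l1_dist (a, b) (i, 0) - l1_dist (c, d) (i, 0) = (int b - int d) + (\<bar>int a - int i\<bar> - \<bar>int c - int i\<bar>)"
    by (simp add: l1_dist_def)
  moreover have "l1_dist (a, b) (i, r - 1) - l1_dist (c, d) (i, r - 1) = - ((int b - int d) - (\<bar>int a - int i\<bar> - \<bar>int c - int i\<bar>))"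
    using assms by (simp add: l1_dist_def of_nat_diff)
  ultimately show ?thesis
    by (simp only: abs_minus_cancel abs_add_plus_abs_diff)
qed

text \<open>Index \<open>t < r\<close> runs along a whole side, corners included; later indices
  start at position 1 of a perpendicular side, so that no corner recurs there. Index 0 is a
  corner.\<close>

definition boundary_fst :: "nat \<Rightarrow> nat \<Rightarrow> nat \<times> nat" where
  "boundary_fst r t = (if t < r then (0, t) else (t - r + 1, 0))"

definition boundary_snd :: "nat \<Rightarrow> nat \<Rightarrow> nat \<Rightarrow> nat \<times> nat" where
  "boundary_snd q r t = (if t < r then (q - 1, t) else (t - r + 1, r - 1))"

lemma boundary_sum_ge:
  assumes "q \<ge> 2" "r \<ge> 2" "1 \<le> m"
    and x: "x \<in> {..<q} \<times> {..<r}" and y: "y \<in> {..<q} \<times> {..<r}" and "x \<noteq> y"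
  shows "2 * int m \<le> (\<Sum>t<m. \<bar>l1_dist x (boundary_fst r t) - l1_dist y (boundary_fst r t)\<bar> +
    \<bar>l1_dist x (boundary_snd q r t) - l1_dist y (boundary_snd q r t)\<bar>)" (is "_ \<le> sum ?f _")
proof -
  obtain a b c d where xy: "x = (a, b)" "y = (c, d)" by (cases x, cases y) auto
  have f: "?f t = (if t < r
      then 2 * max \<bar>int a - int c\<bar> \<bar>\<bar>int b - int t\<bar> - \<bar>int d - int t\<bar>\<bar>
      else 2 * max \<bar>int b - int d\<bar> \<bar>\<bar>int a - int (t - r + 1)\<bar> - \<bar>int c - int (t - r + 1)\<bar>\<bar>)" for t
  proof (cases "t < r")
    case True
    then show ?thesis
      using side_pair_contribution[of a q c b t d] x y xy
      by (simp add: boundary_fst_def boundary_snd_def)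
  next
    case False
    then show ?thesis
      using top_bottom_pair_contribution[of b r d a "t - r + 1" c] x y xy
      by (simp add: boundary_fst_def boundary_snd_def)
  qed
  show ?thesis
  proof (cases "\<forall>t<m. 2 \<le> ?f t")
    case True
    then have "(\<Sum>t<m. 2) \<le> sum ?f {..<m}" by (intro sum_mono) auto
    then show ?thesis by simp
  next
    case False
    then obtain t0 where t0: "t0 < m" "?f t0 < 2" by force
    have f0: "?f 0 = 2 * max \<bar>int a - int c\<bar> \<bar>int b - int d\<bar>"
      using assms(2) by (simp add: f)
    have ne: "a \<noteq> c \<or> b \<noteq> d" using \<open>x \<noteq> y\<close> xy by simp
    \<comment> \<open>A value below 2 is 0, since \<open>?f\<close> is twice an integer. Hence
      \<open>x\<close> and \<open>y\<close> agree in one coordinate, and the position of the pair is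
      their midpoint in the other.\<close>
    have exceptional: "a = c \<and> t0 < r \<and> b + d = 2 * t0 \<or> b = d \<and> r \<le> t0 \<and> a + c = 2 * (t0 - r + 1)"
    proof (cases "t0 < r")
      case True
      then show ?thesis using t0(2) ne unfolding f by simp arith
    next
      case False
      then show ?thesis using t0(2) ne unfolding f by simp arith
    qed
    have even_gap: "2 \<le> \<bar>int u - int v\<bar>" if "u + v = 2 * w" "u \<noteq> v" for u v w :: nat
      using that by arith
    \<comment> \<open>Having an integer midpoint, the differing coordinates are an even, nonzero
      distance apart.\<close>
    have "2 \<le> \<bar>int b - int d\<bar> \<or> 2 \<le> \<bar>int a - int c\<bar>"
      using exceptional ne even_gap[of b d t0] even_gap[of a c "t0 - r + 1"] by blast
    then have "4 \<le> ?f 0"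
      unfolding f0 by (auto simp: max_def)
    \<comment> \<open>The midpoint determines the index, so \<open>t0\<close> is the only
      exception.\<close>
    moreover have "2 \<le> ?f t" if "t \<noteq> t0" for t
      using exceptional ne that unfolding f by (auto split: if_splits)
    moreover have "0 \<le> ?f t0" by simp
    \<comment> \<open>The surplus at index 0 pays for the deficit at \<open>t0\<close>; the two
      indices differ because \<open>?f 0\<close> is at least 4.\<close>
    ultimately have
      "(\<Sum>t<m. 2 + (if t = 0 then 2 else 0) - (if t = t0 then 2 else 0)) \<le> sum ?f {..<m}"
      using t0(2) by (intro sum_mono) auto
    moreover have
      "(\<Sum>t<m. 2 + (if t = 0 then 2 else 0) - (if t = t0 then 2 else 0)) = 2 * int m"
      using t0(1) by (simp add: sum.distrib sum_subtractf)
    ultimately show ?thesis by simp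
  qed
qed

lemma ex_weak_resolving_grid:
  assumes "q \<ge> 2" "r \<ge> 2" "1 \<le> m" "m \<le> q + r - 2" "k \<le> 2 * m"
  shows "\<exists>S. weak_resolving (path_graph q \<box> path_graph r) k S \<and> card S = 2 * m"
proof -
  let ?A = "boundary_fst r ` {..<m}" and ?B = "boundary_snd q r ` {..<m}"
  have injA: "inj_on (boundary_fst r) {..<m}"
    by (auto simp: inj_on_def boundary_fst_def split: if_splits)
  have injB: "inj_on (boundary_snd q r) {..<m}"
    using assms by (auto simp: inj_on_def boundary_snd_def split: if_splits)
  \<comment> \<open>\<open>m \<le> q + r - 2\<close> keeps \<open>t - r + 1\<close> below
    \<open>q - 1\<close>, so \<open>boundary_fst\<close> does not reach the corner
    \<open>(q - 1, 0)\<close>, which is \<open>boundary_snd q r 0\<close>.\<close>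
  have disj: "?A \<inter> ?B = {}"
    using assms by (auto simp: boundary_fst_def boundary_snd_def split: if_splits)
  have sub: "?A \<union> ?B \<subseteq> {..<q} \<times> {..<r}"
    using assms by (auto simp: boundary_fst_def boundary_snd_def split: if_splits)
  have sum: "(\<Sum>s\<in>?A \<union> ?B. g s) = (\<Sum>t<m. g (boundary_fst r t) + g (boundary_snd q r t))"
    for g :: "nat \<times> nat \<Rightarrow> int"
    using injA injB disj by (simp add: sum.union_disjoint sum.reindex sum.distrib)
  have "weak_resolving (path_graph q \<box> path_graph r) k (?A \<union> ?B)"
    unfolding weak_resolving_grid_iff sum
  proof (intro conjI sub ballI impI)
    fix x y assume "x \<in> {..<q} \<times> {..<r}" "y \<in> {..<q} \<times> {..<r}" "x \<noteq> y"
    from boundary_sum_ge[OF assms(1-3) this] assms(5)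
    show "int k \<le> (\<Sum>t<m. \<bar>l1_dist x (boundary_fst r t) - l1_dist y (boundary_fst r t)\<bar> +
      \<bar>l1_dist x (boundary_snd q r t) - l1_dist y (boundary_snd q r t)\<bar>)" by linarith
  qed
  moreover have "card (?A \<union> ?B) = 2 * m"
    using injA injB disj by (simp add: card_Un_disjoint card_image)
  ultimately show ?thesis by blast
qed

theorem theorem4p2:
  fixes q r k :: nat
  assumes "q \<ge> 2" and "r \<ge> 2"
    and "1 \<le> k" and "k \<le> 2 * q + 2 * r - 4"
  shows "wdim k (path_graph q \<box> path_graph r) = (if even k then enat k else enat (k + 1))"
proof -
  let ?n = "if even k then k else k + 1"
  obtain m where m: "?n = 2 * m"
    by (metis even_plus_one_iff evenE)
  \<comment> \<open>The bound on \<open>k\<close> is even, so an odd \<open>k\<close> lies strictly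
    below it and rounding up to \<open>2 * m\<close> stays within it.\<close>
  moreover have "1 \<le> m" "m \<le> q + r - 2" "k \<le> 2 * m"
    using m assms by (auto split: if_splits)
  ultimately obtain S where S: "weak_resolving (path_graph q \<box> path_graph r) k S" "card S = ?n"
    using ex_weak_resolving_grid[OF assms(1,2)] by metis
  have "wdim k (path_graph q \<box> path_graph r) = enat ?n"
    unfolding wdim_def
  proof (rule antisym)
    show "(INF S \<in> {S. weak_resolving (path_graph q \<box> path_graph r) k S}. enat (card S)) \<le> enat ?n"
      using S by (intro INF_lower2[of S]) auto
    show "enat ?n \<le> (INF S \<in> {S. weak_resolving (path_graph q \<box> path_graph r) k S}. enat (card S))"
      using weak_resolving_grid_card_ge[OF assms(1,2)]
      by (intro INF_greatest) (auto simp only: enat_ord_simps mem_Collect_eq)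
  qed
  then show ?thesis by simp
qed

end
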